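(* Let $A\in\mathbb{C}^{n\times n}$ be a BML-matrix, $A^*=p(A)q(A)^{-1}+FG^*$, with $p,q,F,G$ and indices $m_1,m_2,m_3$ as in the context. Let $\mathbf{b}\in\mathbb{C}^n$ be nonzero, denote by $N\le n$ the Arnoldi termination index of $(A,\mathbf{b})$, and let $m:=\max(0,m_1-m_2+1)$. Then the upper Hessenberg matrix $H_N\in\mathbb{C}^{N\times N}$ is $(m,m_2+m_3)$-upper-separable. More precisely, for all $k,\ell$ with $1\le k$ and $k+m\le\ell\le N$, $$(H_N)_{k,\ell}=\sum_{j=1}^{m_2}\overline{d_j\,q_{k-1}(z_j)}\,\bigl((H_N-z_jI_N)^{-*}\bigr)_{1,\ell}+(G_NF_N^* )_{k,\ell},$$ where $z_1,\dots,z_{m_2}$ denote the poles of the rational function $p(z)/q(z)$, $d_1,\dots,d_{m_2}$ are the corresponding coefficients in its partial fraction decomposition, $F_N=V_N^*F$ and $G_N=V_N^*G$.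
   Context: BML-matrix: $A\in\mathbb{C}^{n\times n}$ satisfies $A^*=p(A)q(A)^{-1}+FG^*$, where $p,q$ are polynomials of degree $m_1$ and $m_2$ respectively, the roots of $q$ are simple, $q(A)$ is invertible, and $F,G\in\mathbb{C}^{n\times m_3}$ have full column rank. The poles of $p/q$ are the simple roots $z_1,\dots,z_{m_2}$ of $q$, and the partial fraction decomposition is $\frac{p(z)}{q(z)}=\sum_{j=1}^{m_2}\frac{d_j}{z-z_j}+\pi(z)$ with constants $d_j\in\mathbb{C}$ and a polynomial $\pi$ of degree $m_1-m_2$ ($\pi=0$ if $m_1<m_2$). Arnoldi process: starting from $\mathbf{v}_1=\mathbf{b}/\|\mathbf{b}\|$, the Arnoldi process produces orthonormal vectors $\mathbf{v}_1,\mathbf{v}_2,\dots$ and scalars $h_{j,k}=\mathbf{v}_j^*A\mathbf{v}_k$ with $A\mathbf{v}_k=\sum_{j=1}^{k+1}h_{j,k}\mathbf{v}_j$, $h_{k+1,k}\ge 0$. It terminates at the Arnoldi termination index $N\le n$, the first index for which $\mathbf{v}_{N+1}=0$; thus $h_{k+1,k}>0$ for $1\le k\le N-1$ and, with $V_N=[\mathbf{v}_1,\dots,\mathbf{v}_N]$ and $H_N=(h_{i,j})_{i,j=1}^N$ (upper Hessenberg), $AV_N=V_NH_N$. Polynomials: $q_0(z)=1$ and, for $1\le k\le N-1$, $h_{k+1,k}\,q_k(z)=z\,q_{k-1}(z)-\sum_{j=1}^k h_{j,k}\,q_{j-1}(z)$. (These $q_k$ are not to be confused with the denominator $q$.) Upper-separability: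 a matrix $B\in\mathbb{C}^{N\times N}$ is called $(r,s)$-upper-separable (with $r\in\mathbb{Z}$, $s\ge 0$) if for all $j=1,\dots,N-|r|$ the submatrix of $B$ formed by rows $1,\dots,j-\min(r,0)$ and columns $j+\max(r,0),\dots,N$ has rank at most $s$. $B^{-*}$ denotes $(B^{-1})^*$. *)

theory Defs
  imports
    "Jordan_Normal_Form.Schur_Decomposition"
    "Jordan_Normal_Form.DL_Rank"
    "Jordan_Normal_Form.DL_Submatrix"
    "HOL-Computational_Algebra.Polynomial"
begin

text \<open>
  Vectors and matrices are indexed from 0, so the indices of the Arnoldi vectors, of the
  coefficients \<open>h\<close> and of matrix entries are one less than in the usual 1-based presentation.
  The Arnoldi polynomials are numbered by their degree and are not shifted.
\<close>

definition mat_inv :: "'a :: field mat \<Rightarrow> 'a mat" where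
  "mat_inv M = the (mat_inverse M)"

definition mat_poly :: "'a :: comm_ring_1 poly \<Rightarrow> 'a mat \<Rightarrow> 'a mat" where
  "mat_poly f M = mat (dim_row M) (dim_row M)
     (\<lambda>(i, j). \<Sum>k\<le>degree f. coeff f k * (M ^\<^sub>m k) $$ (i, j))"

text \<open>
  No coprimality of \<open>p\<close> and \<open>q\<close> is required, and \<open>p = 0\<close> is admitted with degree 0.
\<close>

definition bml_matrix ::
  "nat \<Rightarrow> nat \<Rightarrow> nat \<Rightarrow> nat \<Rightarrow> complex mat \<Rightarrow> complex poly \<Rightarrow> complex poly \<Rightarrow>
    complex mat \<Rightarrow> complex mat \<Rightarrow> bool" where
  "bml_matrix n m1 m2 m3 A p q F G \<longleftrightarrow>
     A \<in> carrier_mat n n \<and> F \<in> carrier_mat n m3 \<and> G \<in> carrier_mat n m3 \<and>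
     degree p = m1 \<and> degree q = m2 \<and> rsquarefree q \<and>
     invertible_mat (mat_poly q A) \<and>
     vec_space.rank n F = m3 \<and> vec_space.rank n G = m3 \<and>
     mat_adjoint A = mat_poly p A * mat_inv (mat_poly q A) + F * mat_adjoint G"

definition partial_fraction_decomposition ::
  "complex poly \<Rightarrow> complex poly \<Rightarrow> (nat \<Rightarrow> complex) \<Rightarrow> (nat \<Rightarrow> complex) \<Rightarrow>
    complex poly \<Rightarrow> bool" where
  "partial_fraction_decomposition p q z d \<pi> \<longleftrightarrow>
     bij_betw z {..<degree q} {x. poly q x = 0} \<and>
     (if degree p < degree q then \<pi> = 0 else degree \<pi> = degree p - degree q) \<and>
     (\<forall>x. poly q x \<noteq> 0 \<longrightarrow>
        poly p x / poly q x = (\<Sum>j<degree q. d j / (x - z j)) + poly \<pi> x)"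

definition l2_norm_vec :: "complex vec \<Rightarrow> real" where
  "l2_norm_vec v = sqrt (\<Sum>i<dim_vec v. (cmod (v $ i))\<^sup>2)"

text \<open>
  Since \<open>1 / 0 = 0\<close>, normalizing the residual yields the zero vector exactly when the residual
  vanishes, and all later vectors are then zero as well.
\<close>

fun arnoldi_vec :: "complex mat \<Rightarrow> complex vec \<Rightarrow> nat \<Rightarrow> complex vec" where
  "arnoldi_vec A b 0 = complex_of_real (1 / l2_norm_vec b) \<cdot>\<^sub>v b"
| "arnoldi_vec A b (Suc k) =
     (let u = A *\<^sub>v arnoldi_vec A b k;
          w = vec (dim_vec b)
                (\<lambda>i. u $ i - (\<Sum>j\<le>k. (u \<bullet>c arnoldi_vec A b j) * arnoldi_vec A b j $ i))
      in complex_of_real (1 / l2_norm_vec w) \<cdot>\<^sub>v w)"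

text \<open>\<open>x \<bullet>c y\<close> conjugates \<open>y\<close>, so the following is \<open>h\<^sub>j\<^sub>k = v\<^sub>j\<^sup>* A v\<^sub>k\<close>.\<close>

definition arnoldi_coeff :: "complex mat \<Rightarrow> complex vec \<Rightarrow> nat \<Rightarrow> nat \<Rightarrow> complex" where
  "arnoldi_coeff A b j k = (A *\<^sub>v arnoldi_vec A b k) \<bullet>c arnoldi_vec A b j"

text \<open>
  With 0-based vectors, the first \<open>k\<close> at which the vector vanishes is also the number of
  nonzero Arnoldi vectors.
\<close>

definition arnoldi_index :: "complex mat \<Rightarrow> complex vec \<Rightarrow> nat" where
  "arnoldi_index A b = (LEAST k. arnoldi_vec A b k = 0\<^sub>v (dim_vec b))"

definition arnoldi_basis :: "complex mat \<Rightarrow> complex vec \<Rightarrow> complex mat" where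
  "arnoldi_basis A b = mat_of_cols (dim_vec b) (map (arnoldi_vec A b) [0..<arnoldi_index A b])"

definition arnoldi_hessenberg :: "complex mat \<Rightarrow> complex vec \<Rightarrow> complex mat" where
  "arnoldi_hessenberg A b =
     mat (arnoldi_index A b) (arnoldi_index A b) (\<lambda>(j, k). arnoldi_coeff A b j k)"

text \<open>Only the polynomials of degree less than \<^term>\<open>arnoldi_index A b\<close> are meaningful.\<close>

fun arnoldi_poly :: "complex mat \<Rightarrow> complex vec \<Rightarrow> nat \<Rightarrow> complex poly" where
  "arnoldi_poly A b 0 = 1"
| "arnoldi_poly A b (Suc k) =
     smult (1 / arnoldi_coeff A b (Suc k) k)
       ([:0, 1:] * arnoldi_poly A b k
        - (\<Sum>j\<le>k. smult (arnoldi_coeff A b j k) (arnoldi_poly A b j)))"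

text \<open>
  Here \<open>j\<close> is 1-based: the block consists of the rows \<open>1, \<dots>, j - min r 0\<close> and the columns
  \<open>j + max r 0, \<dots>, N\<close>, and \<open>i + 1\<close> is the 1-based number of the row or column \<open>i\<close>.
\<close>

definition upper_separable :: "nat \<Rightarrow> int \<Rightarrow> nat \<Rightarrow> complex mat \<Rightarrow> bool" where
  "upper_separable N r s B \<longleftrightarrow> B \<in> carrier_mat N N \<and>
     (\<forall>j. 1 \<le> j \<and> j \<le> int N - \<bar>r\<bar> \<longrightarrow>
        (let S = submatrix B {i. int i + 1 \<le> j - min r 0} {i. j + max r 0 \<le> int i + 1}
         in vec_space.rank (dim_row S) S \<le> s))"

end

theory Submission
  imports Defs "HOL-Computational_Algebra.Fundamental_Theorem_Algebra"
begin

text \<open>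
  Since \<open>A V = V H\<close> and \<open>V\<^sup>* V = I\<close>, compressing the hypothesis on \<open>A\<^sup>*\<close> to the Krylov space gives
  \<open>H\<^sup>* = p(H) q(H)\<^sup>-\<^sup>1 + F\<^sub>N G\<^sub>N\<^sup>*\<close>, so everything happens on the unreduced Hessenberg matrix \<open>H\<close>.
  The Arnoldi polynomials satisfy \<open>q\<^sub>k(H) e\<^sub>0 = e\<^sub>k\<close>, and \<open>t(H) e\<^sub>0\<close> has zero \<open>l\<close>-th entry for
  \<open>deg t < l\<close>. Replacing \<open>q\<^sub>k\<close> by its value at \<open>z\<^sub>j\<close> in \<open>(H - z\<^sub>j)\<^sup>-\<^sup>1 q\<^sub>k(H) e\<^sub>0\<close> changes the vector only by
  such a \<open>t(H) e\<^sub>0\<close> with \<open>deg t < k\<close>, and the polynomial part contributes one of degree less than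
  \<open>k + m\<close>. The resulting formula writes the upper blocks as sums of \<open>m2 + m3\<close> rank-one terms.
\<close>

subsection \<open>Inverse, adjoint and rank of matrices\<close>

lemma mat_inv_eqI:
  fixes M :: "'a :: field mat"
  assumes M: "M \<in> carrier_mat N N" and B: "B \<in> carrier_mat N N" and BM: "B * M = 1\<^sub>m N"
  shows "invertible_mat M" and "mat_inv M = B"
proof -
  have MB: "M * B = 1\<^sub>m N"
    using mat_mult_left_right_inverse[OF B M BM] .
  show "invertible_mat M"
    unfolding invertible_mat_def inverts_mat_def using M B MB BM by auto
  \<comment> \<open>\<open>mat_inverse\<close> returns \<open>None\<close> only for non-units of the
    matrix ring; this is what makes the \<open>the\<close> in \<open>mat_inv\<close>
    meaningful.\<close>
  have "M \<in> Units (ring_mat TYPE('a) N ())"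
    unfolding Units_def ring_mat_def using M B MB BM by auto
  then obtain C where C: "mat_inverse M = Some C"
    using mat_inverse(1)[OF M, of "()"] by (cases "mat_inverse M") auto
  from mat_inverse(2)[OF M C] have C': "C * M = 1\<^sub>m N" "M * C = 1\<^sub>m N" "C \<in> carrier_mat N N"
    by auto
  have "C = C * (M * B)" using MB C' by simp
  also have "\<dots> = B" using C' M B by (simp flip: assoc_mult_mat[OF C'(3) M B])
  finally show "mat_inv M = B" by (simp add: mat_inv_def C)
qed

lemma mat_inv_right:
  fixes M :: "'a :: field mat"
  assumes M: "M \<in> carrier_mat N N" and inv: "invertible_mat M"
  shows "mat_inv M \<in> carrier_mat N N" and "mat_inv M * M = 1\<^sub>m N" and "M * mat_inv M = 1\<^sub>m N"
proof -
  obtain B where B: "M * B = 1\<^sub>m (dim_row M)" "B * M = 1\<^sub>m (dim_row B)"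
    using inv by (auto simp: invertible_mat_def inverts_mat_def)
  have "dim_col B = N" "dim_row B = N"
    using arg_cong[OF B(1), of dim_col] arg_cong[OF B(2), of dim_col] M by auto
  then have cB: "B \<in> carrier_mat N N" by auto
  with B M have eq: "M * B = 1\<^sub>m N" "B * M = 1\<^sub>m N" by auto
  have "mat_inv M = B" using mat_inv_eqI(2)[OF M cB eq(2)] .
  then show "mat_inv M \<in> carrier_mat N N" "mat_inv M * M = 1\<^sub>m N" "M * mat_inv M = 1\<^sub>m N"
    using cB eq by auto
qed

lemma mat_adjoint_carrier [simp]:
  "A \<in> carrier_mat r c \<Longrightarrow> mat_adjoint A \<in> carrier_mat c r"
  by (auto simp: mat_adjoint_def mat_of_rows_def)

lemma mat_adjoint_dim [simp]:
  "dim_row (mat_adjoint A) = dim_col A" "dim_col (mat_adjoint A) = dim_row A"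
  by (auto simp: mat_adjoint_def mat_of_rows_def)

lemma mat_adjoint_index [simp]:
  "i < dim_col A \<Longrightarrow> j < dim_row A \<Longrightarrow> mat_adjoint A $$ (i, j) = conjugate (A $$ (j, i))"
  by (simp add: mat_adjoint_def mat_of_rows_def)

lemma mat_adjoint_mult:
  fixes A B :: "'a :: conjugatable_field mat"
  assumes "A \<in> carrier_mat r s" and "B \<in> carrier_mat s c"
  shows "mat_adjoint (A * B) = mat_adjoint B * mat_adjoint A"
proof (rule eq_matI)
  have cd: "mat_adjoint B \<in> carrier_mat c s" "mat_adjoint A \<in> carrier_mat s r"
    "mat_adjoint (A * B) \<in> carrier_mat c r"
    using assms by auto
  note [simp] = carrier_matD[OF assms(1)] carrier_matD[OF assms(2)]
    carrier_matD[OF cd(1)] carrier_matD[OF cd(2)]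
  fix i j assume "i < dim_row (mat_adjoint B * mat_adjoint A)"
    and "j < dim_col (mat_adjoint B * mat_adjoint A)"
  with cd have ij: "i < c" "j < r" by auto
  have "conjugate (\<Sum>x<s. A $$ (j, x) * B $$ (x, i))
      = (\<Sum>x<s. conjugate (A $$ (j, x)) * conjugate (B $$ (x, i)))"
    by (subst sum_conjugate) (simp_all add: conjugate_dist_mul)
  then show "mat_adjoint (A * B) $$ (i, j) = (mat_adjoint B * mat_adjoint A) $$ (i, j)"
    using ij by (simp add: scalar_prod_def atLeast0LessThan mult.commute)
qed simp_all

lemma mat_adjoint_adjoint:
  fixes A :: "'a :: conjugatable_field mat"
  assumes "A \<in> carrier_mat r c"
  shows "mat_adjoint (mat_adjoint A) = A"
  by (rule eq_matI) (use assms in \<open>auto simp: mat_adjoint_def mat_of_rows_def\<close>)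

text \<open>Each summand is an outer product of rank at most 1, and rank is subadditive. In this
  form an entrywise formula turns directly into a rank bound.\<close>

lemma (in vec_space) rank_le_sum_products:
  assumes "A \<in> carrier_mat n nc"
    and "\<And>i j. i < n \<Longrightarrow> j < nc \<Longrightarrow> A $$ (i, j) = (\<Sum>t<s. f t i * g t j)"
  shows "rank A \<le> s"
  using assms
proof (induction s arbitrary: A)
  case 0
  then have "A = 0\<^sub>m n nc" by (intro eq_matI) auto
  then show ?case by (simp add: rank_0I)
next
  case (Suc s)
  define B where "B = mat n nc (\<lambda>(i, j). \<Sum>t<s. f t i * g t j)"
  define C where "C = mat n nc (\<lambda>(i, j). f s i * g s j)"
  have "A = B + C"
    using Suc.prems by (intro eq_matI) (auto simp: B_def C_def)
  moreover have "rank B \<le> s"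
    by (rule Suc.IH) (auto simp: B_def)
  moreover have "rank C \<le> 1"
    by (rule rank_le_1_product_entries[of _ nc "f s" "g s"]) (auto simp: C_def)
  moreover have "rank (B + C) \<le> rank B + rank C"
    by (rule rank_subadditive) (auto simp: B_def C_def)
  ultimately show ?case by simp
qed

subsection \<open>Polynomials of matrices\<close>

lemma mat_poly_carrier [simp]: "M \<in> carrier_mat N N \<Longrightarrow> mat_poly f M \<in> carrier_mat N N"
  by (auto simp: mat_poly_def)

lemma mat_poly_dim [simp]:
  "dim_row (mat_poly f M) = dim_row M" "dim_col (mat_poly f M) = dim_row M"
  by (simp_all add: mat_poly_def)

text \<open>The summation bound \<open>d\<close> is free, so that polynomials of different degrees
  can be expanded over one range; the added coefficients are zero.\<close>

lemma mat_poly_index: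
  assumes "M \<in> carrier_mat N N" and "i < N" and "j < N" and "degree f \<le> d"
  shows "mat_poly f M $$ (i, j) = (\<Sum>k\<le>d. coeff f k * (M ^\<^sub>m k) $$ (i, j))"
  using assms
  by (auto simp: mat_poly_def intro!: sum.mono_neutral_left le_degree)

lemma mat_poly_add:
  assumes M: "M \<in> carrier_mat N N"
  shows "mat_poly (f + g) M = mat_poly f M + mat_poly g M"
proof (rule eq_matI)
  let ?d = "max (degree f) (degree g)"
  fix i j assume "i < dim_row (mat_poly f M + mat_poly g M)"
    and "j < dim_col (mat_poly f M + mat_poly g M)"
  then have ij: "i < N" "j < N" using mat_poly_carrier[OF M, of g] by auto
  note I = mat_poly_index[OF M ij, of _ ?d]
  have "degree (f + g) \<le> ?d" by (rule degree_add_le) auto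
  then show "mat_poly (f + g) M $$ (i, j) = (mat_poly f M + mat_poly g M) $$ (i, j)"
    using ij M by (simp add: I sum.distrib distrib_right)
qed simp_all

lemma mat_poly_smult:
  assumes M: "M \<in> carrier_mat N N"
  shows "mat_poly (smult c f) M = c \<cdot>\<^sub>m mat_poly f M"
proof (rule eq_matI)
  fix i j assume "i < dim_row (c \<cdot>\<^sub>m mat_poly f M)" and "j < dim_col (c \<cdot>\<^sub>m mat_poly f M)"
  then have ij: "i < N" "j < N" using mat_poly_carrier[OF M, of f] by auto
  note I = mat_poly_index[OF M ij, of _ "degree f"]
  show "mat_poly (smult c f) M $$ (i, j) = (c \<cdot>\<^sub>m mat_poly f M) $$ (i, j)"
    using ij M degree_smult_le[of c f] by (simp add: I sum_distrib_left mult.assoc)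
qed simp_all

lemma mat_poly_0: "M \<in> carrier_mat N N \<Longrightarrow> mat_poly 0 M = 0\<^sub>m N N"
  by (rule eq_matI) (auto simp: mat_poly_def)

text \<open>The Horner step, which makes multiplicativity and intertwining simple inductions over
  \<open>pCons\<close>.\<close>

lemma mat_poly_pCons:
  assumes M: "M \<in> carrier_mat N N"
  shows "mat_poly (pCons a f) M = a \<cdot>\<^sub>m 1\<^sub>m N + mat_poly f M * M"
proof (rule eq_matI)
  note [simp] = carrier_matD[OF M] carrier_matD[OF mat_poly_carrier[OF M]]
  fix i j assume "i < dim_row (a \<cdot>\<^sub>m 1\<^sub>m N + mat_poly f M * M)"
    and "j < dim_col (a \<cdot>\<^sub>m 1\<^sub>m N + mat_poly f M * M)"
  then have ij: "i < N" "j < N" by auto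
  have "(mat_poly f M * M) $$ (i, j) = (\<Sum>x<N. mat_poly f M $$ (i, x) * M $$ (x, j))"
    using ij by (simp add: scalar_prod_def atLeast0LessThan)
  also have "\<dots> = (\<Sum>x<N. \<Sum>k\<le>degree f. coeff f k * ((M ^\<^sub>m k) $$ (i, x) * M $$ (x, j)))"
    using ij by (simp add: mat_poly_index[OF M _ _ order_refl] sum_distrib_right mult.assoc)
  also have "\<dots> = (\<Sum>k\<le>degree f. coeff f k * (\<Sum>x<N. (M ^\<^sub>m k) $$ (i, x) * M $$ (x, j)))"
    by (subst sum.swap) (simp add: sum_distrib_left)
  also have "\<dots> = (\<Sum>k\<le>degree f. coeff f k * (M ^\<^sub>m Suc k) $$ (i, j))"
    using ij M by (simp add: scalar_prod_def atLeast0LessThan)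
  finally have prod: "(mat_poly f M * M) $$ (i, j) = \<dots>" .
  have "mat_poly (pCons a f) M $$ (i, j)
      = (\<Sum>k\<le>Suc (degree f). coeff (pCons a f) k * (M ^\<^sub>m k) $$ (i, j))"
    by (rule mat_poly_index[OF M ij]) (rule degree_pCons_le)
  also have "\<dots> = a * 1\<^sub>m N $$ (i, j) + (mat_poly f M * M) $$ (i, j)"
    using M by (simp add: sum.atMost_Suc_shift prod del: sum.atMost_Suc pow_mat.simps(2))
  finally show "mat_poly (pCons a f) M $$ (i, j) = (a \<cdot>\<^sub>m 1\<^sub>m N + mat_poly f M * M) $$ (i, j)"
    using ij by simp
qed (use M in auto)

lemma mat_poly_mult:
  assumes M: "M \<in> carrier_mat N N"
  shows "mat_poly (f * g) M = mat_poly f M * mat_poly g M"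
proof (induction g)
  case 0
  show ?case by (simp add: mat_poly_0[OF M] right_mult_zero_mat[OF mat_poly_carrier[OF M]])
next
  case (pCons a g)
  note c [simp] = mat_poly_carrier[OF M, of f] mat_poly_carrier[OF M, of g]
  have "mat_poly (f * pCons a g) M = a \<cdot>\<^sub>m mat_poly f M + mat_poly (f * g) M * M"
    using mat_poly_carrier[OF M, of "f * g"] M
    by (auto simp: mat_poly_add[OF M] mat_poly_smult[OF M] mat_poly_pCons[OF M])
  also have "\<dots> = mat_poly f M * mat_poly (pCons a g) M"
    using M by (simp add: pCons mat_poly_pCons[OF M] assoc_mult_mat[OF c(1) c(2) M]
        mult_add_distrib_mat[OF c(1) smult_carrier_mat[OF one_carrier_mat] mult_carrier_mat[OF c(2) M]]
        mult_smult_distrib[OF c(1) one_carrier_mat])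
  finally show ?case .
qed

lemma mat_poly_linear:
  assumes M: "M \<in> carrier_mat N N"
  shows "mat_poly [:- c, 1:] M = M - c \<cdot>\<^sub>m 1\<^sub>m N"
proof -
  have "mat_poly [:- c, 1:] M = (- c) \<cdot>\<^sub>m 1\<^sub>m N + (1 \<cdot>\<^sub>m 1\<^sub>m N + 0\<^sub>m N N * M) * M"
    using M by (simp add: mat_poly_pCons[OF M] mat_poly_0[OF M])
  also have "1 \<cdot>\<^sub>m 1\<^sub>m N + 0\<^sub>m N N * M = 1\<^sub>m N" using M by (intro eq_matI) auto
  finally show ?thesis using M by (intro eq_matI) auto
qed

lemma mat_poly_one: "M \<in> carrier_mat N N \<Longrightarrow> mat_poly 1 M = 1\<^sub>m N"
  by (rule eq_matI) (auto simp: mat_poly_def)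

text \<open>By Horner induction, each factor \<open>A\<close> is carried across \<open>V\<close> and
  becomes \<open>H\<close>. This transfers polynomials in \<open>A\<close> to the Krylov
  space.\<close>

lemma mat_poly_intertwine:
  assumes A: "A \<in> carrier_mat n n" and H: "H \<in> carrier_mat N N" and V: "V \<in> carrier_mat n N"
    and AV: "A * V = V * H"
  shows "mat_poly f A * V = V * mat_poly f H"
proof (induction f)
  case 0
  show ?case using V by (simp add: mat_poly_0[OF A] mat_poly_0[OF H])
next
  case (pCons a f)
  note c [simp] = mat_poly_carrier[OF A, of f] mat_poly_carrier[OF H, of f]
  have "mat_poly (pCons a f) A * V = a \<cdot>\<^sub>m V + mat_poly f A * A * V"
    using A V by (simp add: mat_poly_pCons[OF A] mult_smult_assoc_mat[OF one_carrier_mat V]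
        add_mult_distrib_mat[OF smult_carrier_mat[OF one_carrier_mat] mult_carrier_mat[OF c(1) A] V])
  also have "mat_poly f A * A * V = V * mat_poly f H * H"
    using A V H AV pCons by (simp add: assoc_mult_mat[OF c(1) A V] flip: assoc_mult_mat[OF c(1) V H])
  also have "a \<cdot>\<^sub>m V + V * mat_poly f H * H = V * mat_poly (pCons a f) H"
    using V H by (simp add: mat_poly_pCons[OF H] assoc_mult_mat[OF V c(2) H]
        mult_add_distrib_mat[OF V smult_carrier_mat[OF one_carrier_mat] mult_carrier_mat[OF c(2) H]]
        mult_smult_distrib[OF V one_carrier_mat])
  finally show ?case .
qed

text \<open>The left factor \<open>C\<close> allows two uses: with the identity for the Arnoldi
  recurrence and with the inverse of \<open>q(H)\<close> for the pole terms.\<close>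

lemma mat_mult_poly_index_sum:
  assumes M: "M \<in> carrier_mat N N" and C: "C \<in> carrier_mat N N"
    and i: "i < N" and j: "j < N"
  shows "(C * mat_poly (\<Sum>x\<in>S. smult (c x) (f x)) M) $$ (i, j)
    = (\<Sum>x\<in>S. c x * (C * mat_poly (f x) M) $$ (i, j))"
proof (induction S rule: infinite_finite_induct)
  case (insert a S)
  note c = mat_poly_carrier[OF M]
  have "C * mat_poly (\<Sum>x\<in>insert a S. smult (c x) (f x)) M
      = c a \<cdot>\<^sub>m (C * mat_poly (f a) M) + C * mat_poly (\<Sum>x\<in>S. smult (c x) (f x)) M"
    using insert.hyps
    by (simp add: mat_poly_add[OF M] mat_poly_smult[OF M] mult_smult_distrib[OF C c]
        mult_add_distrib_mat[OF C smult_carrier_mat[OF c] c])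
  then show ?case using insert i j C M by simp
qed (use i j C M in \<open>simp_all add: mat_poly_0[OF M]\<close>)

subsection \<open>Rational functions of Hessenberg matrices\<close>

text \<open>Each factor \<open>H\<close> lets the nonzero pattern reach one row further below the
  diagonal. The induction varies \<open>j\<close> because the last factor moves column
  \<open>j\<close> to some column at most \<open>j + 1\<close>.\<close>

lemma hessenberg_pow_index:
  fixes H :: "'a :: semiring_1 mat"
  assumes H: "H \<in> carrier_mat N N"
    and hess: "\<And>i j. i < N \<Longrightarrow> j < N \<Longrightarrow> Suc j < i \<Longrightarrow> H $$ (i, j) = 0"
    and "i < N" "j < N" "j + k < i"
  shows "(H ^\<^sub>m k) $$ (i, j) = 0"
  using assms(3-5)
proof (induction k arbitrary: j)
  case 0
  then show ?case using H by simp
next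
  case (Suc k)
  have "(H ^\<^sub>m k) $$ (i, x) * H $$ (x, j) = 0" if "x < N" for x
    using Suc.IH[of x] Suc.prems hess[of x j] that by (cases "x + k < i") auto
  then show ?case using H Suc.prems by (simp add: scalar_prod_def)
qed

text \<open>The bound is on coefficients and not on the degree, so that \<open>i = 0\<close> forces
  \<open>f = 0\<close>, which no degree inequality could express.\<close>

lemma hessenberg_mat_poly_index:
  fixes H :: "'a :: comm_ring_1 mat"
  assumes H: "H \<in> carrier_mat N N"
    and hess: "\<And>i j. i < N \<Longrightarrow> j < N \<Longrightarrow> Suc j < i \<Longrightarrow> H $$ (i, j) = 0"
    and i: "i < N" and coeff: "\<And>k. i \<le> k \<Longrightarrow> coeff f k = 0"
  shows "mat_poly f H $$ (i, 0) = 0"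
proof -
  have "coeff f k * (H ^\<^sub>m k) $$ (i, 0) = 0" for k
    using hessenberg_pow_index[OF H hess, of i 0 k] i coeff by (cases "k < i") auto
  then show ?thesis
    using i by (simp add: mat_poly_index[OF H _ _ order_refl])
qed

text \<open>The vectors \<open>P k (H) e_0\<close> obey the recurrence that the columns of
  \<open>H\<close> impose on the unit vectors, start at \<open>e_0\<close>, and nonzero subdiagonal
  entries determine each next vector.\<close>

lemma hessenberg_orthogonal_poly:
  fixes H :: "'a :: field mat"
  assumes H: "H \<in> carrier_mat N N"
    and hess: "\<And>i j. i < N \<Longrightarrow> j < N \<Longrightarrow> Suc j < i \<Longrightarrow> H $$ (i, j) = 0"
    and nonzero: "\<And>k. Suc k < N \<Longrightarrow> H $$ (Suc k, k) \<noteq> 0"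
    and P0: "P 0 = 1"
    and PSuc: "\<And>k. Suc k < N \<Longrightarrow>
      [:0, 1:] * P k = (\<Sum>j\<le>Suc k. smult (H $$ (j, k)) (P j))"
    and "k < N" "i < N"
  shows "mat_poly (P k) H $$ (i, 0) = (if i = k then 1 else 0)"
  using assms(6,7)
proof (induction k arbitrary: i rule: less_induct)
  case (less k)
  show ?case
  proof (cases k)
    case 0
    with less.prems show ?thesis by (simp add: P0 mat_poly_one[OF H])
  next
    case (Suc k')
    let ?e = "\<lambda>j. mat_poly (P j) H $$ (i, 0)"
    have N: "0 < N" using less.prems by simp
    have lin: "mat_poly [:0, 1:] H = H"
      using mat_poly_linear[OF H, of 0] H by (simp, intro eq_matI) auto
    \<comment> \<open>Column \<open>k'\<close> of \<open>H\<close> is evaluated in two ways: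
      directly, and as \<open>H * P k' (H) e_0\<close> expanded by the recurrence.\<close>
    have "H $$ (i, k') = (\<Sum>x<N. H $$ (i, x) * mat_poly (P k') H $$ (x, 0))"
      using less.IH[of k'] less.prems Suc by (simp add: if_distrib[of "(*) _"] cong: if_cong)
    also have "\<dots> = (H * mat_poly (P k') H) $$ (i, 0)"
      using less.prems H N by (simp add: scalar_prod_def atLeast0LessThan)
    also have "\<dots> = mat_poly (\<Sum>j\<le>Suc k'. smult (H $$ (j, k')) (P j)) H $$ (i, 0)"
      using PSuc[of k'] less.prems Suc
      by (simp only: mat_poly_mult[OF H, of "[:0, 1:]", unfolded lin, symmetric])
    also have "\<dots> = (\<Sum>j\<le>Suc k'. H $$ (j, k') * ?e j)"
      using mat_mult_poly_index_sum[OF H one_carrier_mat less.prems(2) N, of "\<lambda>j. H $$ (j, k')" P]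
      by (simp only: left_mult_one_mat[OF mat_poly_carrier[OF H]])
    also have "\<dots> = (\<Sum>j\<le>k'. H $$ (j, k') * (if i = j then 1 else 0)) + H $$ (k, k') * ?e k"
      using less.IH less.prems Suc by simp
    also have "(\<Sum>j\<le>k'. H $$ (j, k') * (if i = j then 1 else 0)) = (if i \<le> k' then H $$ (i, k') else 0)"
      by (simp add: if_distrib[of "(*) _"] cong: if_cong)
    \<comment> \<open>In rows up to \<open>k'\<close> the earlier terms already account for the
      whole column; below row \<open>k\<close> the column is zero by \<open>hess\<close>. Only row
      \<open>k\<close> remains.\<close>
    finally have "H $$ (k, k') * ?e k = (if i \<le> k' then 0 else H $$ (i, k'))"
      by (auto split: if_splits)
    also have "\<dots> = H $$ (k, k') * (if i = k then 1 else 0)"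
      using hess[of i k'] less.prems Suc by auto
    finally show ?thesis using nonzero[of k'] less.prems Suc by simp
  qed
qed

lemma coeff_synthetic_div_eq_0:
  assumes "degree f \<le> i"
  shows "coeff (synthetic_div f c) i = 0"
proof (cases "degree f = 0")
  case True
  then show ?thesis using synthetic_div_eq_0_iff[of f c] by simp
next
  case False
  then show ?thesis using assms by (intro coeff_eq_0) (simp add: degree_synthetic_div)
qed

lemma synthetic_div_root:
  fixes q :: "'a :: comm_ring_1 poly"
  shows "poly q c = 0 \<Longrightarrow> [:- c, 1:] * synthetic_div q c = q"
  using synthetic_div_correct'[of c q] by simp

text \<open>Polynomials in \<open>H\<close> commute with each other, hence also with the inverse of
  one of them: insert \<open>Q * q(H)\<close> on the left, swap, and cancel \<open>q(H) * Q\<close>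
  on the right.\<close>

lemma mat_poly_inverse_commute:
  fixes H :: "'a :: field mat"
  assumes H: "H \<in> carrier_mat N N" and Q: "Q \<in> carrier_mat N N"
    and inv: "Q * mat_poly q H = 1\<^sub>m N"
  shows "mat_poly p H * Q = Q * mat_poly p H"
proof -
  note c = mat_poly_carrier[OF H]
  note inv' = mat_mult_left_right_inverse[OF Q c inv]
  have "mat_poly p H * Q = Q * mat_poly q H * (mat_poly p H * Q)"
    by (simp only: inv left_mult_one_mat[OF mult_carrier_mat[OF c Q]])
  also have "\<dots> = Q * (mat_poly q H * mat_poly p H) * Q"
    by (simp add: assoc_mult_mat[OF Q c mult_carrier_mat[OF c Q]]
        assoc_mult_mat[OF Q mult_carrier_mat[OF c c] Q] assoc_mult_mat[OF c c Q])
  also have "mat_poly q H * mat_poly p H = mat_poly p H * mat_poly q H"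
    by (simp only: mat_poly_mult[OF H, symmetric] mult.commute)
  also have "Q * (mat_poly p H * mat_poly q H) * Q = Q * mat_poly p H * (mat_poly q H * Q)"
    by (simp add: assoc_mult_mat[OF Q c mult_carrier_mat[OF c Q]]
        assoc_mult_mat[OF Q mult_carrier_mat[OF c c] Q] assoc_mult_mat[OF c c Q])
  also have "\<dots> = Q * mat_poly p H"
    by (simp only: inv' right_mult_one_mat[OF mult_carrier_mat[OF Q c]])
  finally show ?thesis .
qed

text \<open>At a root \<open>c\<close>, \<open>synthetic_div q c\<close> is the cofactor
  \<open>q / (x - c)\<close>, so multiplying it at \<open>H\<close> by the inverse of
  \<open>q(H)\<close> inverts the shifted matrix.\<close>

lemma mat_inv_shift:
  fixes H :: "'a :: field mat"
  assumes H: "H \<in> carrier_mat N N" and Q: "Q \<in> carrier_mat N N"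
    and inv: "Q * mat_poly q H = 1\<^sub>m N" and root: "poly q c = 0"
  shows "invertible_mat (H - c \<cdot>\<^sub>m 1\<^sub>m N)"
    and "mat_inv (H - c \<cdot>\<^sub>m 1\<^sub>m N) = Q * mat_poly (synthetic_div q c) H"
proof -
  note c = mat_poly_carrier[OF H]
  have "Q * mat_poly (synthetic_div q c) H * (H - c \<cdot>\<^sub>m 1\<^sub>m N)
      = Q * mat_poly (synthetic_div q c * [:- c, 1:]) H"
    by (simp only: mat_poly_mult[OF H] assoc_mult_mat[OF Q c c] mat_poly_linear[OF H, symmetric])
  also have "\<dots> = 1\<^sub>m N"
    using synthetic_div_root[OF root] inv by (simp only: mult.commute)
  finally have *: "Q * mat_poly (synthetic_div q c) H * (H - c \<cdot>\<^sub>m 1\<^sub>m N) = 1\<^sub>m N" .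
  have M: "H - c \<cdot>\<^sub>m 1\<^sub>m N \<in> carrier_mat N N" using H by (simp add: minus_carrier_mat)
  from mat_inv_eqI[OF M mult_carrier_mat[OF Q c] *]
  show "invertible_mat (H - c \<cdot>\<^sub>m 1\<^sub>m N)"
    and "mat_inv (H - c \<cdot>\<^sub>m 1\<^sub>m N) = Q * mat_poly (synthetic_div q c) H" .
qed

text \<open>Since \<open>f(H) e_0 = e_k\<close>, the entry belongs to
  \<open>(p f / q)(H) e_0\<close>. Splitting \<open>p f / q\<close> into its pole terms and a
  polynomial \<open>t\<close> leaves only the pole terms, because \<open>t\<close> has no
  coefficients from index \<open>l\<close> on and \<open>H\<close> is Hessenberg.\<close>

lemma hessenberg_rational_index:
  fixes H :: "'a :: field mat"
  assumes H: "H \<in> carrier_mat N N"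
    and hess: "\<And>i j. i < N \<Longrightarrow> j < N \<Longrightarrow> Suc j < i \<Longrightarrow> H $$ (i, j) = 0"
    and Q: "Q \<in> carrier_mat N N" and inv: "Q * mat_poly q H = 1\<^sub>m N"
    and p: "p = (\<Sum>j<s. smult (d j) (synthetic_div q (z j))) + \<pi> * q"
    and root: "\<And>j. j < s \<Longrightarrow> poly q (z j) = 0"
    and f: "\<And>i. i < N \<Longrightarrow> mat_poly f H $$ (i, 0) = (if i = k then 1 else 0)"
    and deg: "degree f \<le> l" and coeff: "\<And>i. l \<le> i \<Longrightarrow> coeff (\<pi> * f) i = 0"
    and k: "k < N" and l: "l < N"
  shows "(mat_poly p H * Q) $$ (l, k)
    = (\<Sum>j<s. d j * poly f (z j) * mat_inv (H - z j \<cdot>\<^sub>m 1\<^sub>m N) $$ (l, 0))"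
proof -
  note c = mat_poly_carrier[OF H]
  let ?r = "\<lambda>j. synthetic_div q (z j)"
  \<comment> \<open>\<open>t\<close> is \<open>p f / q\<close> with its simple poles at the \<open>z j\<close> removed.\<close>
  define t where "t = (\<Sum>j<s. smult (d j) (synthetic_div f (z j))) + \<pi> * f"
  have N: "0 < N" using k by simp
  note comm = mat_poly_inverse_commute[OF H Q inv]
  have "(mat_poly p H * Q) $$ (l, k)
      = (\<Sum>x<N. (mat_poly p H * Q) $$ (l, x) * mat_poly f H $$ (x, 0))"
    using k f by (simp add: if_distrib[of "(*) _"] cong: if_cong)
  also have "\<dots> = (mat_poly p H * Q * mat_poly f H) $$ (l, 0)"
    using l H Q N by (simp add: scalar_prod_def atLeast0LessThan)
  also have "mat_poly p H * Q * mat_poly f H = Q * mat_poly (p * f) H"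
    by (simp add: comm mat_poly_mult[OF H] assoc_mult_mat[OF Q c c])
  also have "p * f = (\<Sum>j<s. smult (d j * poly f (z j)) (?r j)) + q * t"
  proof -
    \<comment> \<open>Division of \<open>f\<close> by \<open>x - z j\<close> leaves the remainder
      \<open>f(z j)\<close>; the divisor times the cofactor \<open>?r j\<close> is \<open>q\<close>
      again.\<close>
    have "?r j * f = smult (poly f (z j)) (?r j) + q * synthetic_div f (z j)" if "j < s" for j
    proof -
      have "?r j * f = ?r j * ([:- z j, 1:] * synthetic_div f (z j) + [:poly f (z j):])"
        by (simp only: synthetic_div_correct')
      also have "\<dots> = smult (poly f (z j)) (?r j)
          + ([:- z j, 1:] * ?r j) * synthetic_div f (z j)"
        by (simp add: algebra_simps)
      finally show ?thesis by (simp only: synthetic_div_root[OF root[OF that]])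
    qed
    then show ?thesis
      by (simp add: p t_def algebra_simps sum_distrib_left sum_distrib_right sum.distrib smult_add_right)
  qed
  also have "(Q * mat_poly ((\<Sum>j<s. smult (d j * poly f (z j)) (?r j)) + q * t) H) $$ (l, 0)
      = (\<Sum>j<s. d j * poly f (z j) * (Q * mat_poly (?r j) H) $$ (l, 0)) + mat_poly t H $$ (l, 0)"
  proof -
    \<comment> \<open>\<open>Q\<close> cancels \<open>q(H)\<close>, so the second summand
      contributes a pure polynomial in \<open>H\<close>.\<close>
    have "Q * mat_poly (q * t) H = mat_poly t H"
      by (simp add: mat_poly_mult[OF H] assoc_mult_mat[OF Q c c, symmetric] inv left_mult_one_mat[OF c])
    then show ?thesis
      using l N Q H mat_mult_poly_index_sum[OF H Q l N]
      by (simp add: mat_poly_add[OF H] mult_add_distrib_mat[OF Q c c] del: index_mult_mat(1))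
  qed
  also have "mat_poly t H $$ (l, 0) = 0"
  proof (rule hessenberg_mat_poly_index[OF H hess l])
    fix i assume "l \<le> i"
    then show "coeff t i = 0"
      using deg coeff by (simp add: t_def coeff_sum coeff_synthetic_div_eq_0)
  qed
  finally show ?thesis by (simp add: mat_inv_shift(2)[OF H Q inv root])
qed

subsection \<open>The Arnoldi process\<close>

lemma cscalar_prod_sum:
  fixes x y :: "complex vec"
  assumes "y \<in> carrier_vec n"
  shows "x \<bullet>c y = (\<Sum>i<n. x $ i * cnj (y $ i))"
  using assms by (simp add: scalar_prod_def atLeast0LessThan)

lemma cscalar_prod_commute_cnj:
  fixes x y :: "complex vec"
  assumes "x \<in> carrier_vec n" and "y \<in> carrier_vec n"
  shows "x \<bullet>c y = cnj (y \<bullet>c x)"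
  by (simp add: cscalar_prod_sum[OF assms(1)] cscalar_prod_sum[OF assms(2)] mult.commute)

lemma cscalar_prod_self: "x \<bullet>c x = complex_of_real ((l2_norm_vec x)\<^sup>2)"
  by (simp add: cscalar_prod_sum[OF carrier_vec_dim_vec] l2_norm_vec_def sum_nonneg
      complex_norm_square del: of_real_power)

lemma l2_norm_vec_eq_0_iff: "x \<in> carrier_vec n \<Longrightarrow> l2_norm_vec x = 0 \<longleftrightarrow> x = 0\<^sub>v n"
  using conjugate_square_eq_0_vec[of x n] by (simp add: cscalar_prod_self)

text \<open>The first claim includes \<open>x = 0\<close>, where the convention
  \<open>1 / 0 = 0\<close> makes both sides zero. This keeps the Arnoldi relation valid at
  termination.\<close>

lemma l2_normalize:
  assumes x: "x \<in> carrier_vec n" and u: "u = complex_of_real (1 / l2_norm_vec x) \<cdot>\<^sub>v x"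
  shows "x = complex_of_real (l2_norm_vec x) \<cdot>\<^sub>v u"
    and "u \<noteq> 0\<^sub>v n \<Longrightarrow> u \<bullet>c u = 1"
proof -
  show *: "x = complex_of_real (l2_norm_vec x) \<cdot>\<^sub>v u"
    using x l2_norm_vec_eq_0_iff[OF x] by (intro eq_vecI) (auto simp: u)
  assume "u \<noteq> 0\<^sub>v n"
  then have "x \<noteq> 0\<^sub>v n" using x by (auto simp: u)
  then have nz: "l2_norm_vec x \<noteq> 0" using l2_norm_vec_eq_0_iff[OF x] by simp
  have "u \<in> carrier_vec n" using x by (simp add: u)
  then have "u \<bullet>c u = complex_of_real (1 / l2_norm_vec x) * complex_of_real (1 / l2_norm_vec x) * (x \<bullet>c x)"
    using x by (simp add: cscalar_prod_sum u sum_distrib_left mult_ac)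
  then show "u \<bullet>c u = 1" using nz by (simp add: cscalar_prod_self power2_eq_square)
qed

text \<open>Otherwise the first \<open>n\<close> vectors form a unitary matrix \<open>U\<close>, and
  \<open>u n\<close>, being orthogonal to all of them, satisfies \<open>U^* u n = 0\<close>. Then
  \<open>u n = 0\<close>, against its norm 1. The bound forces the Arnoldi process to
  terminate.\<close>

lemma orthonormal_length_le:
  fixes u :: "nat \<Rightarrow> complex vec"
  assumes u: "\<And>i. u i \<in> carrier_vec n"
    and orth: "\<And>i j. i < K \<Longrightarrow> j < K \<Longrightarrow> u i \<bullet>c u j = (if i = j then 1 else 0)"
  shows "K \<le> n"
proof (rule ccontr)
  assume "\<not> K \<le> n"
  then have nK: "n < K" by simp
  define U where "U = mat n n (\<lambda>(i, j). u j $ i)"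
  have U: "U \<in> carrier_mat n n" and U': "mat_adjoint U \<in> carrier_mat n n"
    by (simp_all add: U_def)
  have "mat_adjoint U * U = 1\<^sub>m n"
  proof (rule eq_matI)
    fix i j assume ij: "i < dim_row (1\<^sub>m n :: complex mat)" "j < dim_col (1\<^sub>m n :: complex mat)"
    then have "(mat_adjoint U * U) $$ (i, j) = u j \<bullet>c u i"
      by (simp add: U_def cscalar_prod_sum[OF u] scalar_prod_def atLeast0LessThan mult.commute
          carrier_vecD[OF u])
    then show "(mat_adjoint U * U) $$ (i, j) = 1\<^sub>m n $$ (i, j)"
      using ij nK by (simp add: orth)
  qed (simp_all add: U_def)
  from mat_mult_left_right_inverse[OF U' U this] have inv: "U * mat_adjoint U = 1\<^sub>m n" .
  have "mat_adjoint U *\<^sub>v u n = 0\<^sub>v n"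
  proof (rule eq_vecI)
    fix i assume "i < dim_vec (0\<^sub>v n :: complex vec)"
    then have "i < n" by simp
    then have "(mat_adjoint U *\<^sub>v u n) $ i = u n \<bullet>c u i"
      using u[of n]
      by (simp add: U_def cscalar_prod_sum[OF u] scalar_prod_def atLeast0LessThan mult.commute
          carrier_vecD[OF u])
    then show "(mat_adjoint U *\<^sub>v u n) $ i = 0\<^sub>v n $ i"
      using \<open>i < n\<close> nK by (simp add: orth)
  qed (simp add: U_def)
  moreover have "U *\<^sub>v 0\<^sub>v n = 0\<^sub>v n"
    using U by (intro eq_vecI) (simp_all add: scalar_prod_def)
  ultimately have "u n = 0\<^sub>v n"
    using assoc_mult_mat_vec[OF U U' u[of n]] inv u[of n] by simp
  then show False
    using orth[of n n] nK by simp
qed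

context
  fixes A :: "complex mat" and b :: "complex vec" and n :: nat
  assumes A: "A \<in> carrier_mat n n" and b: "b \<in> carrier_vec n"
begin

text \<open>The Gram-Schmidt remainder \<open>w\<close> inside \<open>arnoldi_vec\<close>, before
  normalization, expressed through the Hessenberg coefficients.\<close>

definition arnoldi_residual :: "nat \<Rightarrow> complex vec" where
  "arnoldi_residual k = vec n (\<lambda>i. (A *\<^sub>v arnoldi_vec A b k) $ i
     - (\<Sum>j\<le>k. arnoldi_coeff A b j k * arnoldi_vec A b j $ i))"

lemma arnoldi_vec_Suc_residual:
  "arnoldi_vec A b (Suc k)
    = complex_of_real (1 / l2_norm_vec (arnoldi_residual k)) \<cdot>\<^sub>v arnoldi_residual k"
  using b by (simp add: arnoldi_residual_def arnoldi_coeff_def Let_def)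

lemma arnoldi_vec_carrier: "arnoldi_vec A b k \<in> carrier_vec n"
  using b by (cases k) (simp_all add: Let_def)

lemma arnoldi_residual_eq:
  "arnoldi_residual k = complex_of_real (l2_norm_vec (arnoldi_residual k)) \<cdot>\<^sub>v arnoldi_vec A b (Suc k)"
  by (rule l2_normalize(1)[OF _ arnoldi_vec_Suc_residual]) (simp add: arnoldi_residual_def)

lemma arnoldi_residual_cscalar_prod:
  assumes "u \<in> carrier_vec n"
  shows "arnoldi_residual k \<bullet>c u = (A *\<^sub>v arnoldi_vec A b k) \<bullet>c u
    - (\<Sum>j\<le>k. arnoldi_coeff A b j k * (arnoldi_vec A b j \<bullet>c u))"
proof -
  have "(\<Sum>i<n. (\<Sum>j\<le>k. arnoldi_coeff A b j k * arnoldi_vec A b j $ i) * cnj (u $ i))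
      = (\<Sum>j\<le>k. arnoldi_coeff A b j k * (\<Sum>i<n. arnoldi_vec A b j $ i * cnj (u $ i)))"
    by (simp add: sum_distrib_left sum_distrib_right mult.assoc sum.swap[of _ "{..k}"])
  then show ?thesis
    by (simp add: cscalar_prod_sum[OF assms] arnoldi_residual_def left_diff_distrib sum_subtractf)
qed

text \<open>Stated for any initial run of nonzero vectors, so that it is available before
  termination is known. For \<open>i\<close> at most \<open>k\<close>, orthonormality of the earlier
  vectors collapses the subtracted sum to \<open>(A v_k) \<bullet>c v_i\<close>, so the residual is
  orthogonal to \<open>v_i\<close>.\<close>

lemma arnoldi_vec_orthonormal:
  assumes "\<And>k. k < K \<Longrightarrow> arnoldi_vec A b k \<noteq> 0\<^sub>v n" and "i < K" and "j < K"
  shows "arnoldi_vec A b i \<bullet>c arnoldi_vec A b j = (if i = j then 1 else 0)"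
  using assms
proof (induction K arbitrary: i j)
  case (Suc K)
  let ?v = "arnoldi_vec A b"
  have norm: "?v K \<bullet>c ?v K = 1"
  proof (cases K)
    case 0
    then show ?thesis using l2_normalize(2)[OF b] Suc.prems(1)[of K] by simp
  next
    case (Suc k)
    then show ?thesis
      using l2_normalize(2)[OF _ arnoldi_vec_Suc_residual] Suc.prems(1)[of K]
      by (simp add: arnoldi_residual_def del: arnoldi_vec.simps)
  qed
  have orth: "?v K \<bullet>c ?v i = 0" if "i < K" for i
  proof -
    from that obtain k where k: "K = Suc k" by (cases K) auto
    have "arnoldi_residual k \<bullet>c ?v i = 0"
      using that k Suc.IH[OF Suc.prems(1), of _ i]
      by (simp add: arnoldi_residual_cscalar_prod[OF arnoldi_vec_carrier] arnoldi_coeff_def[symmetric]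
          if_distrib[of "(*) _"] cong: if_cong)
    then show ?thesis
      using carrier_vecD[OF arnoldi_vec_carrier[of i]]
      unfolding k arnoldi_vec_Suc_residual by (simp add: arnoldi_residual_def)
  qed
  have orth': "?v i \<bullet>c ?v K = 0" if "i < K" for i
    using cscalar_prod_commute_cnj[OF arnoldi_vec_carrier[of i] arnoldi_vec_carrier[of K]]
      orth[OF that] by simp
  show ?case
    using Suc.IH[OF Suc.prems(1), of i j] Suc.prems(2,3) norm orth orth'
    by (cases "i = K"; cases "j = K") auto
qed simp

text \<open>Some vector must vanish, since \<open>n + 1\<close> nonzero ones would be orthonormal in
  dimension \<open>n\<close>; hence the \<open>LEAST\<close> in \<open>arnoldi_index\<close> is
  attained.\<close>

lemma arnoldi_vec_index: "arnoldi_vec A b (arnoldi_index A b) = 0\<^sub>v n"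
proof -
  have "\<exists>k. arnoldi_vec A b k = 0\<^sub>v n"
    using orthonormal_length_le[of "arnoldi_vec A b" n "Suc n", OF arnoldi_vec_carrier
        arnoldi_vec_orthonormal[of "Suc n"]]
    by auto
  from LeastI_ex[OF this] show ?thesis
    using b by (simp add: arnoldi_index_def)
qed

lemma arnoldi_vec_nonzero: "k < arnoldi_index A b \<Longrightarrow> arnoldi_vec A b k \<noteq> 0\<^sub>v n"
  using not_less_Least b unfolding arnoldi_index_def by fastforce

lemma arnoldi_orthonormal:
  "i < arnoldi_index A b \<Longrightarrow> j < arnoldi_index A b \<Longrightarrow>
    arnoldi_vec A b i \<bullet>c arnoldi_vec A b j = (if i = j then 1 else 0)"
  by (rule arnoldi_vec_orthonormal[OF arnoldi_vec_nonzero])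

text \<open>Below the diagonal the projection terms are orthogonal to \<open>v_i\<close>, and the
  residual is its norm times \<open>v_(k+1)\<close>. This gives both the Hessenberg shape and the
  subdiagonal entries.\<close>

lemma arnoldi_coeff_beyond:
  assumes "k < i" and "i < arnoldi_index A b"
  shows "arnoldi_coeff A b i k
    = (if i = Suc k then complex_of_real (l2_norm_vec (arnoldi_residual k)) else 0)"
proof -
  let ?v = "arnoldi_vec A b"
  have "arnoldi_coeff A b i k = arnoldi_residual k \<bullet>c ?v i"
    using assms
    by (simp add: arnoldi_residual_cscalar_prod[OF arnoldi_vec_carrier] arnoldi_coeff_def
        arnoldi_orthonormal)
  also have "\<dots> = complex_of_real (l2_norm_vec (arnoldi_residual k)) * (?v (Suc k) \<bullet>c ?v i)"
    using carrier_vecD[OF arnoldi_vec_carrier[of "Suc k"]]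
    by (subst arnoldi_residual_eq)
      (simp add: cscalar_prod_sum[OF arnoldi_vec_carrier] sum_distrib_left mult.assoc
        del: arnoldi_vec.simps)
  finally show ?thesis
    using assms by (simp add: arnoldi_orthonormal del: arnoldi_vec.simps)
qed

lemma arnoldi_coeff_subdiagonal:
  assumes "Suc k < arnoldi_index A b"
  shows "arnoldi_coeff A b (Suc k) k \<noteq> 0"
proof -
  have "l2_norm_vec (arnoldi_residual k) \<noteq> 0"
    using arnoldi_vec_nonzero[OF assms] carrier_vecD[OF arnoldi_vec_carrier[of "Suc k"]]
    unfolding arnoldi_vec_Suc_residual by (auto simp: arnoldi_residual_def)
  then show ?thesis using arnoldi_coeff_beyond[of k "Suc k"] assms by simp
qed

lemma arnoldi_mult_vec_index:
  assumes k: "k < arnoldi_index A b" and i: "i < n"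
  shows "(A *\<^sub>v arnoldi_vec A b k) $ i
    = (\<Sum>j<arnoldi_index A b. arnoldi_coeff A b j k * arnoldi_vec A b j $ i)"
proof -
  let ?N = "arnoldi_index A b" and ?v = "arnoldi_vec A b" and ?h = "arnoldi_coeff A b"
  have "(A *\<^sub>v ?v k) $ i = (\<Sum>j\<le>k. ?h j k * ?v j $ i) + arnoldi_residual k $ i"
    using i by (simp add: arnoldi_residual_def)
  also have "arnoldi_residual k $ i = (\<Sum>j\<in>{k<..<?N}. ?h j k * ?v j $ i)"
  proof (cases "Suc k < ?N")
    case True
    have "(\<Sum>j\<in>{k<..<?N}. ?h j k * ?v j $ i) = (\<Sum>j\<in>{Suc k}. ?h j k * ?v j $ i)"
      using True by (intro sum.mono_neutral_right) (auto simp: arnoldi_coeff_beyond)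
    also have "\<dots> = arnoldi_residual k $ i"
      using True i carrier_vecD[OF arnoldi_vec_carrier[of "Suc k"]]
      by (subst arnoldi_residual_eq) (simp add: arnoldi_coeff_beyond del: arnoldi_vec.simps)
    finally show ?thesis by simp
  next
    case False
    \<comment> \<open>In the last column the residual is a multiple of the vector at the termination
      index, which is zero. Hence \<open>A V = V H\<close> closes without a remainder.\<close>
    then have N: "?N = Suc k" "{k<..<?N} = {}" using k by auto
    then show ?thesis
      using i arnoldi_vec_index by (subst arnoldi_residual_eq) (simp del: arnoldi_vec.simps)
  qed
  also have "(\<Sum>j\<le>k. ?h j k * ?v j $ i) + \<dots> = (\<Sum>j\<in>{..k} \<union> {k<..<?N}. ?h j k * ?v j $ i)"
    by (rule sum.union_disjoint[symmetric]) auto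
  also have "{..k} \<union> {k<..<?N} = {..<?N}" using k by auto
  finally show ?thesis .
qed

lemma arnoldi_basis_carrier: "arnoldi_basis A b \<in> carrier_mat n (arnoldi_index A b)"
  using b by (auto simp: arnoldi_basis_def)

lemma arnoldi_basis_index:
  "i < n \<Longrightarrow> j < arnoldi_index A b \<Longrightarrow> arnoldi_basis A b $$ (i, j) = arnoldi_vec A b j $ i"
  using b by (simp add: arnoldi_basis_def mat_of_cols_index)

lemma arnoldi_hessenberg_carrier:
  "arnoldi_hessenberg A b \<in> carrier_mat (arnoldi_index A b) (arnoldi_index A b)"
  by (simp add: arnoldi_hessenberg_def)

lemma arnoldi_basis_isometry:
  "mat_adjoint (arnoldi_basis A b) * arnoldi_basis A b = 1\<^sub>m (arnoldi_index A b)"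
proof (rule eq_matI)
  let ?N = "arnoldi_index A b" and ?V = "arnoldi_basis A b"
  note [simp] = carrier_matD[OF arnoldi_basis_carrier]
  fix i j assume ij: "i < dim_row (1\<^sub>m ?N :: complex mat)" "j < dim_col (1\<^sub>m ?N :: complex mat)"
  then have "(mat_adjoint ?V * ?V) $$ (i, j) = arnoldi_vec A b j \<bullet>c arnoldi_vec A b i"
    by (simp add: arnoldi_basis_index cscalar_prod_sum[OF arnoldi_vec_carrier] scalar_prod_def
        atLeast0LessThan mult.commute carrier_vecD[OF arnoldi_vec_carrier])
  then show "(mat_adjoint ?V * ?V) $$ (i, j) = 1\<^sub>m ?N $$ (i, j)"
    using ij arnoldi_orthonormal[of j i] by simp
qed (simp_all add: carrier_matD[OF arnoldi_basis_carrier])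

lemma arnoldi_basis_intertwine:
  "A * arnoldi_basis A b = arnoldi_basis A b * arnoldi_hessenberg A b"
proof (rule eq_matI)
  let ?N = "arnoldi_index A b" and ?V = "arnoldi_basis A b" and ?H = "arnoldi_hessenberg A b"
  note [simp] = carrier_matD[OF arnoldi_basis_carrier] carrier_matD[OF arnoldi_hessenberg_carrier]
  fix i j assume "i < dim_row (?V * ?H)" "j < dim_col (?V * ?H)"
  then have ij: "i < n" "j < ?N" by simp_all
  then have "(A * ?V) $$ (i, j) = (A *\<^sub>v arnoldi_vec A b j) $ i"
    using A carrier_vecD[OF arnoldi_vec_carrier[of j]]
    by (simp add: arnoldi_basis_index scalar_prod_def)
  also have "\<dots> = (?V * ?H) $$ (i, j)"
    using ij by (simp add: arnoldi_mult_vec_index arnoldi_basis_index arnoldi_hessenberg_def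
        scalar_prod_def atLeast0LessThan mult.commute)
  finally show "(A * ?V) $$ (i, j) = (?V * ?H) $$ (i, j)" .
qed (use A carrier_matD[OF arnoldi_basis_carrier] carrier_matD[OF arnoldi_hessenberg_carrier] in simp_all)

lemma arnoldi_poly_recurrence:
  assumes "Suc k < arnoldi_index A b"
  shows "[:0, 1:] * arnoldi_poly A b k
    = (\<Sum>j\<le>Suc k. smult (arnoldi_coeff A b j k) (arnoldi_poly A b j))"
  using arnoldi_coeff_subdiagonal[OF assms] by simp

end

text \<open>Only an upper bound: past termination the division by the subdiagonal coefficient may be
  \<open>1 / 0 = 0\<close>, which yields the zero polynomial.\<close>

lemma degree_arnoldi_poly: "degree (arnoldi_poly A b k) \<le> k"
proof (induction k rule: less_induct)
  case (less k)
  show ?case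
  proof (cases k)
    case (Suc k')
    have "degree ([:0, 1:] * arnoldi_poly A b k') \<le> k"
      using less[of k'] degree_mult_le[of "[:0, 1:]" "arnoldi_poly A b k'"] Suc by simp
    moreover have "degree (\<Sum>j\<le>k'. smult (arnoldi_coeff A b j k') (arnoldi_poly A b j)) \<le> k"
    proof (rule degree_sum_le)
      fix j assume "j \<in> {..k'}"
      then show "degree (smult (arnoldi_coeff A b j k') (arnoldi_poly A b j)) \<le> k"
        using less[of j] Suc degree_smult_le[of "arnoldi_coeff A b j k'" "arnoldi_poly A b j"] by simp
    qed simp
    ultimately show ?thesis
      unfolding Suc arnoldi_poly.simps(2)
      by (intro order_trans[OF degree_smult_le] degree_diff_le)
  qed simp
qed

subsection \<open>Partial fractions\<close>

lemma card_roots_rsquarefree: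
  fixes q :: "complex poly"
  assumes "rsquarefree q"
  shows "card {x. poly q x = 0} = degree q"
proof -
  have q: "q \<noteq> 0" using assms by (simp add: rsquarefree_def)
  have "degree q = degree (smult (lead_coeff q) (\<Prod>x | poly q x = 0. [:- x, 1:]))"
    by (simp add: complex_poly_decompose_rsquarefree[OF assms])
  also have "\<dots> = card {x. poly q x = 0}"
    using q by (simp add: degree_prod_sum_eq)
  finally show ?thesis by simp
qed

text \<open>Clearing denominators gives equality away from the roots of \<open>q\<close>.
  Multiplying the difference by \<open>q\<close> extends it to all points, and a polynomial
  vanishing everywhere is zero.\<close>

lemma partial_fraction_decomposition_poly:
  assumes pfd: "partial_fraction_decomposition p q z d \<pi>" and q: "q \<noteq> 0"
  shows "p = (\<Sum>j<degree q. smult (d j) (synthetic_div q (z j))) + \<pi> * q"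
    (is "p = ?r")
proof -
  have root: "poly q (z j) = 0" if "j < degree q" for j
    using pfd that by (auto simp: partial_fraction_decomposition_def bij_betw_def)
  have "poly p x = poly ?r x" if x: "poly q x \<noteq> 0" for x
  proof -
    have "d j / (x - z j) * poly q x = d j * poly (synthetic_div q (z j)) x" if "j < degree q" for j
    proof -
      have "poly q x = (x - z j) * poly (synthetic_div q (z j)) x"
        using arg_cong[OF synthetic_div_root[OF root[OF that]], of "\<lambda>f. poly f x"]
      by (simp add: algebra_simps)
      moreover have "x \<noteq> z j" using root[OF that] x by auto
      ultimately show ?thesis by simp
    qed
    then have "(\<Sum>j<degree q. d j / (x - z j)) * poly q x = poly (\<Sum>j<degree q. smult (d j) (synthetic_div q (z j))) x"
      by (simp add: sum_distrib_right poly_sum)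
    moreover have "poly p x = ((\<Sum>j<degree q. d j / (x - z j)) + poly \<pi> x) * poly q x"
      using pfd x by (simp add: partial_fraction_decomposition_def field_simps)
    ultimately show ?thesis by (simp add: distrib_right)
  qed
  then have "poly ((p - ?r) * q) x = 0" for x by (cases "poly q x = 0") auto
  then have "(p - ?r) * q = 0" using poly_all_0_iff_0 by blast
  then show ?thesis using q by simp
qed

lemma degree_div_poly:
  fixes p q :: "'a :: field poly"
  assumes "degree q \<le> degree p" and "q \<noteq> 0"
  shows "degree (p div q) = degree p - degree q"
proof (cases "p div q = 0")
  case True
  then have "p mod q = p" using div_mult_mod_eq[of p q] by simp
  then show ?thesis using degree_mod_less[OF assms(2), of p] assms(1) True by auto
next
  case False
  then have deg: "degree (p div q * q) = degree (p div q) + degree q"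
    using assms(2) by (rule degree_mult_eq)
  have "degree (p div q * q + p mod q) = degree (p div q * q)"
  proof (cases "p mod q = 0")
    case False
    then show ?thesis
      using degree_mod_less[OF assms(2), of p] deg by (intro degree_add_eq_left) simp
  qed simp
  then show ?thesis using deg by simp
qed

text \<open>Separability does not mention a decomposition, so one has to be produced. The polynomial
  part is \<open>p div q\<close>, and Lagrange interpolation of \<open>p mod q\<close> at the roots
  of \<open>q\<close> gives the rest.\<close>

lemma partial_fraction_decomposition_exists:
  assumes q: "rsquarefree q"
  shows "\<exists>z d \<pi>. partial_fraction_decomposition p q z d \<pi>"
proof -
  have q0: "q \<noteq> 0" using q by (simp add: rsquarefree_def)
  have fin: "finite {x. poly q x = 0}" using q0 by (rule poly_roots_finite)
  obtain z where z: "bij_betw z {..<degree q} {x. poly q x = 0}"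
    using ex_bij_betw_nat_finite[OF fin] by (auto simp: card_roots_rsquarefree[OF q] atLeast0LessThan)
  have root: "poly q (z j) = 0" if "j < degree q" for j
    using z that by (auto simp: bij_betw_def)
  let ?s = "\<lambda>j. synthetic_div q (z j)"
  have eval: "(x - z j) * poly (?s j) x = poly q x" if "j < degree q" for j x
    using arg_cong[OF synthetic_div_root[OF root[OF that]], of "\<lambda>f. poly f x"]
      by (simp add: algebra_simps)
  have nz: "poly (?s j) (z j) \<noteq> 0" if j: "j < degree q" for j
  proof
    assume "poly (?s j) (z j) = 0"
    \<comment> \<open>By the product rule, the cofactor at its own root equals
      \<open>q'(z j)\<close>, which is nonzero at a simple root.\<close>
    moreover have "pderiv ([:- z j, 1:] * ?s j) = [:- z j, 1:] * pderiv (?s j) + ?s j * 1"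
      unfolding pderiv_mult by (simp add: pderiv_pCons flip: one_pCons)
    then have "pderiv q = [:- z j, 1:] * pderiv (?s j) + ?s j"
      by (simp only: synthetic_div_root[OF root[OF j]] mult_1_right)
    ultimately have "poly (pderiv q) (z j) = 0" by simp
    then show False using q root[OF j] by (auto simp: rsquarefree_roots)
  qed
  \<comment> \<open>The residue of \<open>p / q\<close> at \<open>z j\<close>: every other cofactor
    \<open>?s i\<close> vanishes at \<open>z j\<close>, so this value is forced.\<close>
  define d where "d j = poly (p mod q) (z j) / poly (?s j) (z j)" for j
  let ?r = "\<Sum>j<degree q. smult (d j) (?s j)"
  have pq: "p mod q = ?r"
  proof (cases "degree q = 0")
    case True
    then show ?thesis using degree_mod_less[OF q0, of p] by simp
  next
    case False
    \<comment> \<open>Both sides have degree below the number of roots of \<open>q\<close>, so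
      agreement at the roots suffices.\<close>
    have "card {x. poly q x = 0} = degree q" by (rule card_roots_rsquarefree[OF q])
    moreover have "degree (p mod q) < degree q"
      using degree_mod_less[OF q0, of p] False by auto
    moreover have "degree ?r < degree q"
    proof (rule degree_sum_less)
      fix j
      show "degree (smult (d j) (?s j)) < degree q"
        using False degree_smult_le[of "d j" "?s j"] by (simp add: degree_synthetic_div)
    qed (use False in simp)
    moreover have "poly (p mod q) x = poly ?r x" if "x \<in> {x. poly q x = 0}" for x
    proof -
      have "x \<in> z ` {..<degree q}" using bij_betw_imp_surj_on[OF z] that by simp
      then obtain i where i: "i < degree q" "x = z i" by auto
      have "poly (?s j) x = 0" if "j < degree q" "j \<noteq> i" for j
      proof -
        have "x \<noteq> z j" using z that i by (auto simp: bij_betw_def inj_on_def)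
        then show ?thesis using eval[OF that(1), of x] root[OF i(1)] i(2) by simp
      qed
      then have "poly ?r x = (\<Sum>j<degree q. if j = i then d i * poly (?s i) x else 0)"
        unfolding poly_sum by (intro sum.cong) auto
      then show ?thesis using i nz[OF i(1)] by (simp add: d_def)
    qed
    ultimately show ?thesis by (intro poly_eqI_degree[of "{x. poly q x = 0}"]) auto
  qed
  have "partial_fraction_decomposition p q z d (p div q)"
    unfolding partial_fraction_decomposition_def
  proof (intro conjI allI impI)
    show "if degree p < degree q then p div q = 0 else degree (p div q) = degree p - degree q"
      using q0 by (simp add: div_poly_less degree_div_poly)
    fix x assume x: "poly q x \<noteq> 0"
    have "d j * poly (?s j) x / poly q x = d j / (x - z j)" if "j < degree q" for j
    proof -
      have "x \<noteq> z j" using root[OF that] x by auto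
      then show ?thesis using eval[OF that, of x] x by (simp add: frac_eq_eq mult_ac)
    qed
    then have "poly ?r x / poly q x = (\<Sum>j<degree q. d j / (x - z j))"
      by (simp add: poly_sum sum_divide_distrib)
    moreover have "poly p x = poly (p div q) x * poly q x + poly ?r x"
      using arg_cong[OF div_mult_mod_eq[of p q], of "\<lambda>f. poly f x"] pq by simp
    ultimately show "poly p x / poly q x = (\<Sum>j<degree q. d j / (x - z j)) + poly (p div q) x"
      using x by (simp add: add_divide_distrib)
  qed (rule z)
  then show ?thesis by blast
qed

subsection \<open>Separability of the Hessenberg matrix\<close>

text \<open>The column set of an upper block is unbounded as a set of naturals, so membership is
  needed for infinite \<open>I\<close> as well; the premise is the bound that
  \<open>dim_submatrix\<close> provides.\<close>

lemma pick_mem: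
  assumes "i < card {a. a < n \<and> a \<in> I}"
  shows "pick I i \<in> I"
proof (rule pick_in_set)
  have "card {a. a < n \<and> a \<in> I} \<le> card I" if "finite I"
    using that by (intro card_mono) auto
  then show "i < card I \<or> infinite I" using assms by auto
qed

lemma upper_separableI:
  assumes B: "B \<in> carrier_mat N N"
    and entry: "\<And>k l. k + m \<le> l \<Longrightarrow> l < N \<Longrightarrow> B $$ (k, l) = (\<Sum>t<s. f t k * g t l)"
  shows "upper_separable N (int m) s B"
  unfolding upper_separable_def Let_def
proof (intro conjI allI impI)
  fix j :: int
  let ?I = "{i. int i + 1 \<le> j - min (int m) 0}" and ?J = "{i. j + max (int m) 0 \<le> int i + 1}"
  let ?S = "submatrix B ?I ?J"
  show "vec_space.rank (dim_row ?S) ?S \<le> s"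
  proof (rule vec_space.rank_le_sum_products[of _ _ "dim_col ?S"])
    fix k l assume "k < dim_row ?S" and "l < dim_col ?S"
    then have k: "k < card {i. i < N \<and> i \<in> ?I}" and l: "l < card {i. i < N \<and> i \<in> ?J}"
      using B by (simp_all add: dim_submatrix)
    \<comment> \<open>A row index \<open>a\<close> satisfies \<open>a + 1 <= j\<close> and a column
      index \<open>c\<close> satisfies \<open>j + m <= c + 1\<close>, so the whole block lies in the
      region covered by \<open>entry\<close>.\<close>
    have "pick ?I k + m \<le> pick ?J l"
      using pick_mem[OF k] pick_mem[OF l] by simp
    moreover have "pick ?J l < N" using l by (rule pick_le)
    moreover have "?S $$ (k, l) = B $$ (pick ?I k, pick ?J l)"
      using k l B by (intro submatrix_index) simp_all
    ultimately show "?S $$ (k, l) = (\<Sum>t<s. f t (pick ?I k) * g t (pick ?J l))"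
      by (simp add: entry)
  qed simp
qed (rule B)

text \<open>The hypothesis on the adjoint of \<open>A\<close> is multiplied by \<open>V^*\<close>
  and \<open>V\<close>. The range of \<open>V\<close> is invariant under \<open>A\<close>, so
  polynomials pass from \<open>A\<close> to \<open>H\<close>, and the compression of the inverse of
  \<open>q(A)\<close> inverts \<open>q(H)\<close>.\<close>

lemma arnoldi_hessenberg_adjoint:
  assumes bml: "bml_matrix n m1 m2 m3 A p q F G" and b: "b \<in> carrier_vec n"
    and N: "N = arnoldi_index A b" and V: "V = arnoldi_basis A b" and H: "H = arnoldi_hessenberg A b"
  obtains Q where "Q \<in> carrier_mat N N" and "Q * mat_poly q H = 1\<^sub>m N"
    and "mat_adjoint H = mat_poly p H * Q + (mat_adjoint V * F) * mat_adjoint (mat_adjoint V * G)"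
proof
  from bml have A: "A \<in> carrier_mat n n" and F: "F \<in> carrier_mat n m3" and G: "G \<in> carrier_mat n m3"
    and inv: "invertible_mat (mat_poly q A)"
    and A': "mat_adjoint A = mat_poly p A * mat_inv (mat_poly q A) + F * mat_adjoint G"
    by (simp_all add: bml_matrix_def)
  note ca = mat_poly_carrier[OF A]
  note Hc = arnoldi_hessenberg_carrier[OF A b, folded N H]
  note ch = mat_poly_carrier[OF Hc]
  note Vc = arnoldi_basis_carrier[OF A b, folded N V]
  note VV = arnoldi_basis_isometry[OF A b, folded N V]
  note AV = arnoldi_basis_intertwine[OF A b, folded V H]
  note fV = mat_poly_intertwine[OF A Hc Vc AV]
  define R where "R = mat_inv (mat_poly q A)"
  define W where "W = mat_adjoint V"
  note Rc = mat_inv_right(1)[OF ca inv, folded R_def]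
  note Rq = mat_inv_right(2)[OF ca inv, folded R_def]
  have Wc: "W \<in> carrier_mat N n" unfolding W_def using Vc by simp
  have W': "mat_adjoint W = V" unfolding W_def by (rule mat_adjoint_adjoint[OF Vc])
  define Q where "Q = W * R * V"
  show Qc: "Q \<in> carrier_mat N N"
    unfolding Q_def using Wc Rc Vc by auto
  have QV: "Q * mat_poly f H = W * (R * mat_poly f A) * V" for f
  proof -
    have "Q * mat_poly f H = W * R * (V * mat_poly f H)"
      unfolding Q_def by (rule assoc_mult_mat[OF mult_carrier_mat[OF Wc Rc] Vc ch])
    also have "\<dots> = W * R * mat_poly f A * V"
      by (simp only: fV[symmetric] assoc_mult_mat[OF mult_carrier_mat[OF Wc Rc] ca Vc])
    also have "W * R * mat_poly f A = W * (R * mat_poly f A)"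
      by (rule assoc_mult_mat[OF Wc Rc ca])
    finally show ?thesis .
  qed
  show inv': "Q * mat_poly q H = 1\<^sub>m N"
    using QV[of q] by (simp only: Rq right_mult_one_mat[OF Wc] VV[folded W_def])
  have "W * A * V = W * V * H"
    by (simp only: assoc_mult_mat[OF Wc A Vc] AV assoc_mult_mat[OF Wc Vc Hc])
  also have "\<dots> = H"
    by (simp only: VV[folded W_def] left_mult_one_mat[OF Hc])
  finally have "mat_adjoint H = mat_adjoint (W * A * V)" by simp
  also have "\<dots> = W * (mat_adjoint A * V)"
    by (simp only: mat_adjoint_mult[OF mult_carrier_mat[OF Wc A] Vc] mat_adjoint_mult[OF Wc A]
        W' W_def[symmetric])
  \<comment> \<open>The inverse \<open>R\<close> is moved to the left of \<open>p(A)\<close>: then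
    the polynomial stands next to \<open>V\<close>, where the intertwining relation applies.\<close>
  also have "mat_adjoint A * V = R * mat_poly p A * V + F * mat_adjoint G * V"
    unfolding A' R_def[symmetric] mat_poly_inverse_commute[OF A Rc Rq]
    using Rc A F G Vc by (intro add_mult_distrib_mat) auto
  also have "W * \<dots> = W * (R * mat_poly p A * V) + W * (F * mat_adjoint G * V)"
    using Wc Rc A F G Vc by (intro mult_add_distrib_mat) auto
  also have "W * (R * mat_poly p A * V) = Q * mat_poly p H"
    by (simp only: QV assoc_mult_mat[OF Wc mult_carrier_mat[OF Rc ca] Vc])
  also have "Q * mat_poly p H = mat_poly p H * Q"
    using mat_poly_inverse_commute[OF Hc Qc inv'] by simp
  also have "W * (F * mat_adjoint G * V) = W * F * (mat_adjoint G * V)"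
    by (simp only: assoc_mult_mat[OF F mat_adjoint_carrier[OF G] Vc]
        assoc_mult_mat[OF Wc F mult_carrier_mat[OF mat_adjoint_carrier[OF G] Vc]])
  also have "mat_adjoint G * V = mat_adjoint (W * G)"
    by (simp only: mat_adjoint_mult[OF Wc G] W')
  finally show "mat_adjoint H
      = mat_poly p H * Q + (mat_adjoint V * F) * mat_adjoint (mat_adjoint V * G)"
    by (simp only: W_def)
qed

text \<open>Invertibility of the shifted matrices is part of the conclusion because
  \<open>mat_inv\<close> carries information only for invertible arguments. Quantifying over all
  decompositions covers every numbering of the poles. The 0-based row \<open>k\<close> corresponds
  to the polynomial of degree index \<open>k\<close>.\<close>

theorem corollary3p2:
  fixes n m1 m2 m3 m N :: nat
    and A F G V H F_N G_N :: "complex mat"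
    and b :: "complex vec"
    and p q :: "complex poly"
  assumes "bml_matrix n m1 m2 m3 A p q F G"
    and "b \<in> carrier_vec n" and "b \<noteq> 0\<^sub>v n"
    and "N = arnoldi_index A b"
    and "m = nat (max 0 (int m1 - int m2 + 1))"
    and "V = arnoldi_basis A b"
    and "H = arnoldi_hessenberg A b"
    and "F_N = mat_adjoint V * F"
    and "G_N = mat_adjoint V * G"
  shows "upper_separable N (int m) (m2 + m3) H \<and>
    (\<forall>z d \<pi>. partial_fraction_decomposition p q z d \<pi> \<longrightarrow>
       (\<forall>j<m2. invertible_mat (H - z j \<cdot>\<^sub>m 1\<^sub>m N)) \<and>
       (\<forall>k l. k + m \<le> l \<and> l < N \<longrightarrow>
          H $$ (k, l) =
            (\<Sum>j<m2. cnj (d j * poly (arnoldi_poly A b k) (z j)) *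
               mat_adjoint (mat_inv (H - z j \<cdot>\<^sub>m 1\<^sub>m N)) $$ (0, l))
            + (G_N * mat_adjoint F_N) $$ (k, l)))"
proof -
  note b = assms(2) and N = assms(4) and m = assms(5) and V = assms(6) and H = assms(7)
  from assms(1) have A: "A \<in> carrier_mat n n" and F: "F \<in> carrier_mat n m3"
    and G: "G \<in> carrier_mat n m3" and m1: "degree p = m1" and m2: "degree q = m2"
    and q: "rsquarefree q"
    by (simp_all add: bml_matrix_def)
  have q0: "q \<noteq> 0" using q by (simp add: rsquarefree_def)
  have Hc: "H \<in> carrier_mat N N"
    unfolding N H by (rule arnoldi_hessenberg_carrier[OF A b])
  have H_index: "H $$ (i, j) = arnoldi_coeff A b i j" if "i < N" "j < N" for i j
    using that by (simp add: N H arnoldi_hessenberg_def)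
  have Vc: "V \<in> carrier_mat n N"
    unfolding N V by (rule arnoldi_basis_carrier[OF A b])
  have Fc: "F_N \<in> carrier_mat N m3" and Gc: "G_N \<in> carrier_mat N m3"
    using mat_adjoint_carrier[OF Vc] F G by (auto simp: assms(8,9))
  have hess: "H $$ (i, j) = 0" if "i < N" "j < N" "Suc j < i" for i j
    using that arnoldi_coeff_beyond[OF A b, of j i] by (simp add: H_index N)
  have basis: "mat_poly (arnoldi_poly A b k) H $$ (i, 0) = (if i = k then 1 else 0)"
    if "k < N" "i < N" for k i
  proof (rule hessenberg_orthogonal_poly[OF Hc hess])
    fix k assume k: "Suc k < N"
    then show "H $$ (Suc k, k) \<noteq> 0"
      using arnoldi_coeff_subdiagonal[OF A b] by (simp add: H_index N)
    show "[:0, 1:] * arnoldi_poly A b k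
        = (\<Sum>j\<le>Suc k. smult (H $$ (j, k)) (arnoldi_poly A b j))"
      using k arnoldi_poly_recurrence[OF A b, of k] by (simp add: H_index N del: sum.atMost_Suc)
  qed (use that in simp_all)
  obtain Q where Qc: "Q \<in> carrier_mat N N" and inv: "Q * mat_poly q H = 1\<^sub>m N"
    and H': "mat_adjoint H = mat_poly p H * Q + F_N * mat_adjoint G_N"
    using arnoldi_hessenberg_adjoint[OF assms(1) b N V H] unfolding assms(8,9) by blast
  have root: "poly q (z j) = 0"
    if "partial_fraction_decomposition p q z d \<pi>" "j < m2" for z d \<pi> j
    using that m2 by (auto simp: partial_fraction_decomposition_def bij_betw_def)
  have entry: "H $$ (k, l) =
      (\<Sum>j<m2. cnj (d j * poly (arnoldi_poly A b k) (z j)) *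
         mat_adjoint (mat_inv (H - z j \<cdot>\<^sub>m 1\<^sub>m N)) $$ (0, l))
      + (G_N * mat_adjoint F_N) $$ (k, l)"
    if pfd: "partial_fraction_decomposition p q z d \<pi>" and kl: "k + m \<le> l" "l < N" for z d \<pi> k l
  proof -
    let ?f = "arnoldi_poly A b k"
    let ?B = "\<lambda>j. mat_inv (H - z j \<cdot>\<^sub>m 1\<^sub>m N)"
    have k: "k < N" using kl by simp
    \<comment> \<open>A nonzero polynomial part requires \<open>m2 <= m1\<close>; then
      \<open>m = m1 - m2 + 1\<close> and the product has degree at most
      \<open>m1 - m2 + k < k + m <= l\<close>. The \<open>+ 1\<close> in \<open>m\<close> makes this
      strict.\<close>
    have coeff: "coeff (\<pi> * ?f) i = 0" if "l \<le> i" for i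
    proof (cases "\<pi> = 0")
      case False
      then have "m2 \<le> m1" "degree \<pi> = m1 - m2"
        using pfd by (auto simp: partial_fraction_decomposition_def m1 m2 split: if_splits)
      then have "degree (\<pi> * ?f) < i"
        using degree_mult_le[of \<pi> ?f] degree_arnoldi_poly[of A b k] kl that m by simp
      then show ?thesis by (rule coeff_eq_0)
    qed simp
    have B: "?B j \<in> carrier_mat N N" if "j < m2" for j
      using mat_inv_shift(2)[OF Hc Qc inv root[OF pfd that]] Qc mat_poly_carrier[OF Hc] by auto
    \<comment> \<open>The rational function represents the adjoint of \<open>H\<close>, so the upper
      entry is computed as a lower one there and conjugated back.\<close>
    have "cnj (H $$ (k, l)) = mat_adjoint H $$ (l, k)"
      using k kl Hc by simp
    also have "\<dots> = (mat_poly p H * Q) $$ (l, k) + (F_N * mat_adjoint G_N) $$ (l, k)"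
      unfolding H' using k kl Fc Gc by (intro index_add_mat) auto
    also have "(mat_poly p H * Q) $$ (l, k) = (\<Sum>j<m2. d j * poly ?f (z j) * ?B j $$ (l, 0))"
    proof (rule hessenberg_rational_index[OF Hc hess Qc inv _ _ _ _ coeff k])
      show "p = (\<Sum>j<m2. smult (d j) (synthetic_div q (z j))) + \<pi> * q"
        using partial_fraction_decomposition_poly[OF pfd q0] by (simp add: m2)
      show "degree ?f \<le> l" using degree_arnoldi_poly[of A b k] kl by simp
    qed (use root[OF pfd] basis k kl in auto)
    finally have "cnj (cnj (H $$ (k, l))) = cnj ((\<Sum>j<m2. d j * poly ?f (z j) * ?B j $$ (l, 0))
        + (F_N * mat_adjoint G_N) $$ (l, k))"
      by (rule arg_cong)
    then have "H $$ (k, l) = (\<Sum>j<m2. cnj (d j * poly ?f (z j)) * cnj (?B j $$ (l, 0)))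
        + cnj ((F_N * mat_adjoint G_N) $$ (l, k))"
      by (simp del: index_mult_mat(1))
    also have "(\<Sum>j<m2. cnj (d j * poly ?f (z j)) * cnj (?B j $$ (l, 0)))
        = (\<Sum>j<m2. cnj (d j * poly ?f (z j)) * mat_adjoint (?B j) $$ (0, l))"
      using k kl carrier_matD[OF B] by (intro sum.cong) auto
    also have "cnj ((F_N * mat_adjoint G_N) $$ (l, k)) = (G_N * mat_adjoint F_N) $$ (k, l)"
    proof -
      have "G_N * mat_adjoint F_N = mat_adjoint (F_N * mat_adjoint G_N)"
        using mat_adjoint_mult[OF Fc mat_adjoint_carrier[OF Gc]] by (simp add: mat_adjoint_adjoint[OF Gc])
      then show ?thesis using k kl Fc Gc by (simp del: index_mult_mat(1))
    qed
    finally show ?thesis .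
  qed
  have "upper_separable N (int m) (m2 + m3) H"
  proof -
    obtain z d \<pi> where pfd: "partial_fraction_decomposition p q z d \<pi>"
      using partial_fraction_decomposition_exists[OF q] by blast
    \<comment> \<open>\<open>f\<close> and \<open>g\<close> list the column and row factors of the
      rank-one terms: \<open>m2\<close> from the poles, then \<open>m3\<close> from the columns of
      \<open>G_N\<close> and \<open>F_N\<close>.\<close>
    define f where "f t k = (if t < m2 then cnj (d t * poly (arnoldi_poly A b k) (z t))
      else G_N $$ (k, t - m2))" for t k
    define g where "g t l = (if t < m2 then mat_adjoint (mat_inv (H - z t \<cdot>\<^sub>m 1\<^sub>m N)) $$ (0, l)
      else cnj (F_N $$ (l, t - m2)))" for t l
    show ?thesis
    proof (rule upper_separableI[OF Hc])
      fix k l assume kl: "k + m \<le> l" "l < N"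
      have "(G_N * mat_adjoint F_N) $$ (k, l) = (\<Sum>t<m3. f (t + m2) k * g (t + m2) l)"
        using kl carrier_matD[OF Fc] carrier_matD[OF Gc]
        by (simp add: f_def g_def scalar_prod_def atLeast0LessThan)
      also have "\<dots> = (\<Sum>t = m2..<m2 + m3. f t k * g t l)"
        using sum.shift_bounds_nat_ivl[of "\<lambda>t. f t k * g t l" 0 m2 m3]
        by (simp add: atLeast0LessThan add.commute)
      moreover have "(\<Sum>j<m2. cnj (d j * poly (arnoldi_poly A b k) (z j)) *
          mat_adjoint (mat_inv (H - z j \<cdot>\<^sub>m 1\<^sub>m N)) $$ (0, l)) = (\<Sum>t = 0..<m2. f t k * g t l)"
        unfolding atLeast0LessThan by (intro sum.cong) (simp_all add: f_def g_def)
      ultimately have "H $$ (k, l) = (\<Sum>t = 0..<m2. f t k * g t l) + (\<Sum>t = m2..<m2 + m3. f t k * g t l)"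
        using entry[OF pfd kl] by simp
      then show "H $$ (k, l) = (\<Sum>t<m2 + m3. f t k * g t l)"
        by (simp add: sum.atLeastLessThan_concat flip: atLeast0LessThan)
    qed
  qed
  moreover have "invertible_mat (H - z j \<cdot>\<^sub>m 1\<^sub>m N)"
    if "partial_fraction_decomposition p q z d \<pi>" "j < m2" for z d \<pi> j
    using mat_inv_shift(1)[OF Hc Qc inv root[OF that]] .
  ultimately show ?thesis using entry by blast
qed

end
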